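(* The category of locally small generalized topological spaces (as objects) with strictly continuous mappings (as morphisms) is concretely isomorphic to the category of locally small spaces (as objects) with bounded continuous mappings (as morphisms).
   Context: For families of sets, $\mathcal{U}\cap_1\mathcal{V}=\{U\cap V: U\in\mathcal{U},V\in\mathcal{V}\}$, and $V\cap_1\mathcal{U}=\{V\cap U:U\in\mathcal{U}\}$ for a set $V$. A family $\mathcal{U}$ is a refinement of $\mathcal{V}$ if each member of $\mathcal{U}$ is contained in some member of $\mathcal{V}$. A family $\mathcal{U}$ of sets is essentially finite if some finite subfamily $\mathcal{U}_f\subseteq\mathcal{U}$ satisfies $\bigcup\mathcal{U}_f=\bigcup\mathcal{U}$; it is essentially finite on a set $S$ if $\mathcal{U}\cap_1 S=\{U\cap S:U\in\mathcal{U}\}$ is essentially finite. A (Delfs-Knebusch) generalized topological space (gts) is a triple $(X,Op_X,Cov_X)$ with $X$ a set, $Op_X\subseteq\mathcal{P}(X)$ (open sets), $Cov_X\subseteq\mathcal{P}(Op_X)$ (admissible families) such that: (finiteness) if $\mathcal{U}\subseteq Op_X$ is finite, then $\mathcal{U}\in Cov_X$ and $\bigcup\mathcal{U},\bigcap\mathcal{U}\in Op_X$ (with $\bigcap\emptyset=X$); (stability) if $V\in Op_X$ and $\mathcal{U}\in Cov_X$, then $V\cap_1\mathcal{U}\in Cov_X$; (transitivity) if $\mathcal{U}\in Cov_X$ and, for each $U\in\mathcal{U}$, $\mathcal{V}(U)\in Cov_X$ with $\bigcup\mathcal{V}(U)=U$, then $\bigcup_{U\in\mathcal{U}}\mathcal{V}(U)\in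 Cov_X$; (saturation) if $\mathcal{U}\in Cov_X$, $\mathcal{V}\subseteq Op_X$, $\bigcup\mathcal{U}=\bigcup\mathcal{V}$ and $\mathcal{U}$ is a refinement of $\mathcal{V}$, then $\mathcal{V}\in Cov_X$; (regularity) if $\mathcal{U}\in Cov_X$, $W\subseteq\bigcup\mathcal{U}$ and $W\cap_1\mathcal{U}\subseteq Op_X$, then $W\in Op_X$. A mapping between gtses is strictly continuous if the preimage $f^{-1}(\mathcal{V})=\{f^{-1}(V):V\in\mathcal{V}\}$ of every admissible family $\mathcal{V}$ is an admissible family. A set $S\subseteq X$ is small if each admissible family is essentially finite on $S$. A gts is locally small if there exists an admissible covering of $X$ by small open sets. A locally small space is a pair $(X,\mathcal{L}_X)$ with $X$ a set and $\mathcal{L}_X\subseteq\mathcal{P}(X)$ such that $\emptyset\in\mathcal{L}_X$, $L\cap M,L\cup M\in\mathcal{L}_X$ for all $L,M\in\mathcal{L}_X$, and $\bigcup\mathcal{L}_X=X$. Put $\mathcal{L}_X^o=\{V\subseteq X: V\cap L\in\mathcal{L}_X\text{ for all }L\in\mathcal{L}_X\}$. A mapping $f:X\to Y$ between locally small spaces $(X,\mathcal{L}_X)$, $(Y,\mathcal{L}_Y)$ is bounded if $\mathcal{L}_X$ is a refinement of $f^{-1}(\mathcal{L}_Y)=\{f^{-1}(L):L\in\mathcal{L}_Y\}$, and continuous if $f^{-1}(\mathcal{L}_Y)\subseteq\mathcal{L}_X^o$. Two concrete categories over sets are concretely isomorphic if there is an isomorphism of categories between them commuting with the forgetful functors to sets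 (i.e. preserving underlying sets and underlying mappings). *)

theory Defs
  imports Main "HOL-Library.FuncSet"
begin

record ('o, 'm) category =
  Obj :: "'o set"
  Arr :: "'m set"
  Dom :: "'m \<Rightarrow> 'o"
  Cod :: "'m \<Rightarrow> 'o"
  Id :: "'o \<Rightarrow> 'm"
  Comp :: "'m \<Rightarrow> 'm \<Rightarrow> 'm"

definition hom :: "('o, 'm) category \<Rightarrow> 'o \<Rightarrow> 'o \<Rightarrow> 'm set" where
  "hom C a b = {f \<in> Arr C. Dom C f = a \<and> Cod C f = b}"

text \<open>\<open>Comp C g f\<close> is the composite ``first \<open>f\<close>, then \<open>g\<close>''.\<close>

definition is_category :: "('o, 'm) category \<Rightarrow> bool" where
  "is_category C \<longleftrightarrow>
     (\<forall>f\<in>Arr C. Dom C f \<in> Obj C \<and> Cod C f \<in> Obj C) \<and>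
     (\<forall>a\<in>Obj C. Id C a \<in> hom C a a) \<and>
     (\<forall>a\<in>Obj C. \<forall>b\<in>Obj C. \<forall>c\<in>Obj C. \<forall>f\<in>hom C a b. \<forall>g\<in>hom C b c. Comp C g f \<in> hom C a c) \<and>
     (\<forall>a\<in>Obj C. \<forall>b\<in>Obj C. \<forall>f\<in>hom C a b. Comp C f (Id C a) = f \<and> Comp C (Id C b) f = f) \<and>
     (\<forall>a\<in>Obj C. \<forall>b\<in>Obj C. \<forall>c\<in>Obj C. \<forall>d\<in>Obj C. \<forall>f\<in>hom C a b. \<forall>g\<in>hom C b c. \<forall>h\<in>hom C c d.
        Comp C h (Comp C g f) = Comp C (Comp C h g) f)"

definition is_functor ::
    "('o, 'm) category \<Rightarrow> ('p, 'n) category \<Rightarrow> ('o \<Rightarrow> 'p) \<Rightarrow> ('m \<Rightarrow> 'n) \<Rightarrow> bool" where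
  "is_functor C D Fo Fm \<longleftrightarrow>
     (\<forall>a\<in>Obj C. Fo a \<in> Obj D) \<and>
     (\<forall>a\<in>Obj C. \<forall>b\<in>Obj C. \<forall>f\<in>hom C a b. Fm f \<in> hom D (Fo a) (Fo b)) \<and>
     (\<forall>a\<in>Obj C. Fm (Id C a) = Id D (Fo a)) \<and>
     (\<forall>a\<in>Obj C. \<forall>b\<in>Obj C. \<forall>c\<in>Obj C. \<forall>f\<in>hom C a b. \<forall>g\<in>hom C b c.
        Fm (Comp C g f) = Comp D (Fm g) (Fm f))"

definition faithful ::
    "('o, 'm) category \<Rightarrow> ('m \<Rightarrow> 'n) \<Rightarrow> bool" where
  "faithful C Fm \<longleftrightarrow> (\<forall>a\<in>Obj C. \<forall>b\<in>Obj C. inj_on Fm (hom C a b))"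

definition category_isomorphism ::
    "('o, 'm) category \<Rightarrow> ('p, 'n) category \<Rightarrow> ('o \<Rightarrow> 'p) \<Rightarrow> ('m \<Rightarrow> 'n) \<Rightarrow> bool" where
  "category_isomorphism C D Fo Fm \<longleftrightarrow>
     is_functor C D Fo Fm \<and>
     (\<exists>Go Gm. is_functor D C Go Gm \<and>
        (\<forall>a\<in>Obj C. Go (Fo a) = a) \<and> (\<forall>f\<in>Arr C. Gm (Fm f) = f) \<and>
        (\<forall>b\<in>Obj D. Fo (Go b) = b) \<and> (\<forall>g\<in>Arr D. Fm (Gm g) = g))"

text \<open>The category of all structures in \<open>Os\<close>, where \<open>u\<close> gives the underlying set of a structure
  and \<open>P S T f\<close> says that the mapping \<open>f\<close> from \<open>u S\<close> to \<open>u T\<close> is a morphism. Arrows are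
  triples (domain, mapping, codomain); mappings are extensional (\<open>undefined\<close> outside their domain),
  so that equal arrows are exactly equal mappings between the same structures. The type \<open>'a\<close>
  is the universe from which underlying sets are taken.\<close>

definition structured_sets ::
    "'s set \<Rightarrow> ('s \<Rightarrow> 'a set) \<Rightarrow> ('s \<Rightarrow> 's \<Rightarrow> ('a \<Rightarrow> 'a) \<Rightarrow> bool)
      \<Rightarrow> ('s, 's \<times> ('a \<Rightarrow> 'a) \<times> 's) category" where
  "structured_sets Os u P =
     \<lparr> Obj = Os,
       Arr = {(S, f, T). S \<in> Os \<and> T \<in> Os \<and> f \<in> u S \<rightarrow>\<^sub>E u T \<and> P S T f},
       Dom = (\<lambda>(S, f, T). S),
       Cod = (\<lambda>(S, f, T). T),
       Id = (\<lambda>S. (S, restrict (\<lambda>x. x) (u S), S)),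
       Comp = (\<lambda>(_, g, T) (S, f, _). (S, compose (u S) g f, T)) \<rparr>"

definition set_category :: "('a set, 'a set \<times> ('a \<Rightarrow> 'a) \<times> 'a set) category" where
  "set_category = structured_sets UNIV (\<lambda>A. A) (\<lambda>_ _ _. True)"

definition forget :: "('s \<Rightarrow> 'a set) \<Rightarrow> 's \<times> ('a \<Rightarrow> 'a) \<times> 's \<Rightarrow> 'a set \<times> ('a \<Rightarrow> 'a) \<times> 'a set" where
  "forget u = (\<lambda>(S, f, T). (u S, f, u T))"

definition concrete_category ::
    "('o, 'm) category \<Rightarrow> ('o \<Rightarrow> 'a set) \<Rightarrow> ('m \<Rightarrow> 'a set \<times> ('a \<Rightarrow> 'a) \<times> 'a set) \<Rightarrow> bool" where
  "concrete_category C Uo Um \<longleftrightarrow>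
     is_category C \<and> is_functor C set_category Uo Um \<and> faithful C Um"

definition concretely_isomorphic ::
    "('o, 'm) category \<Rightarrow> ('o \<Rightarrow> 'a set) \<Rightarrow> ('m \<Rightarrow> 'a set \<times> ('a \<Rightarrow> 'a) \<times> 'a set)
      \<Rightarrow> ('p, 'n) category \<Rightarrow> ('p \<Rightarrow> 'a set) \<Rightarrow> ('n \<Rightarrow> 'a set \<times> ('a \<Rightarrow> 'a) \<times> 'a set) \<Rightarrow> bool" where
  "concretely_isomorphic C Uo Um D Vo Vm \<longleftrightarrow>
     concrete_category C Uo Um \<and> concrete_category D Vo Vm \<and>
     (\<exists>Fo Fm. category_isomorphism C D Fo Fm \<and>
        (\<forall>a\<in>Obj C. Vo (Fo a) = Uo a) \<and> (\<forall>f\<in>Arr C. Vm (Fm f) = Um f))"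

definition cap1 :: "'a set \<Rightarrow> 'a set set \<Rightarrow> 'a set set" where
  "cap1 V \<U> = {V \<inter> U | U. U \<in> \<U>}"

definition refinement :: "'a set set \<Rightarrow> 'a set set \<Rightarrow> bool" where
  "refinement \<U> \<V> \<longleftrightarrow> (\<forall>U\<in>\<U>. \<exists>V\<in>\<V>. U \<subseteq> V)"

definition essentially_finite :: "'a set set \<Rightarrow> bool" where
  "essentially_finite \<U> \<longleftrightarrow> (\<exists>\<U>f. \<U>f \<subseteq> \<U> \<and> finite \<U>f \<and> \<Union>\<U>f = \<Union>\<U>)"

definition essentially_finite_on :: "'a set set \<Rightarrow> 'a set \<Rightarrow> bool" where
  "essentially_finite_on \<U> S \<longleftrightarrow> essentially_finite (cap1 S \<U>)"

text \<open>Preimages are taken in the domain \<open>X\<close> of the mapping, not in the ambient type.\<close>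

definition preimages :: "'a set \<Rightarrow> ('a \<Rightarrow> 'b) \<Rightarrow> 'b set set \<Rightarrow> 'a set set" where
  "preimages X f \<V> = {f -` V \<inter> X | V. V \<in> \<V>}"

record 'a gts =
  gpoints :: "'a set"
  gopen :: "'a set set"
  gcov :: "'a set set set"

text \<open>After the typing conditions on open sets and admissible families come finiteness, stability,
  transitivity, saturation and regularity, in this order. In the finiteness axiom,
  \<open>gpoints X \<inter> \<Inter>\<U>\<close> encodes the convention that the intersection of the empty family is the whole space; for nonempty \<open>\<U>\<close> it is \<open>\<Inter>\<U>\<close>.\<close>

definition is_gts :: "'a gts \<Rightarrow> bool" where
  "is_gts X \<longleftrightarrow>
     gopen X \<subseteq> Pow (gpoints X) \<and>
     gcov X \<subseteq> Pow (gopen X) \<and>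
     (\<forall>\<U>. \<U> \<subseteq> gopen X \<and> finite \<U> \<longrightarrow>
        \<U> \<in> gcov X \<and> \<Union>\<U> \<in> gopen X \<and> gpoints X \<inter> \<Inter>\<U> \<in> gopen X) \<and>
     (\<forall>V\<in>gopen X. \<forall>\<U>\<in>gcov X. cap1 V \<U> \<in> gcov X) \<and>
     (\<forall>\<U>\<in>gcov X. \<forall>\<V>. (\<forall>U\<in>\<U>. \<V> U \<in> gcov X \<and> \<Union>(\<V> U) = U) \<longrightarrow> (\<Union>U\<in>\<U>. \<V> U) \<in> gcov X) \<and>
     (\<forall>\<U>\<in>gcov X. \<forall>\<V>. \<V> \<subseteq> gopen X \<and> \<Union>\<U> = \<Union>\<V> \<and> refinement \<U> \<V> \<longrightarrow> \<V> \<in> gcov X) \<and>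
     (\<forall>\<U>\<in>gcov X. \<forall>W. W \<subseteq> \<Union>\<U> \<and> cap1 W \<U> \<subseteq> gopen X \<longrightarrow> W \<in> gopen X)"

definition strictly_continuous :: "'a gts \<Rightarrow> 'b gts \<Rightarrow> ('a \<Rightarrow> 'b) \<Rightarrow> bool" where
  "strictly_continuous X Y f \<longleftrightarrow> (\<forall>\<V>\<in>gcov Y. preimages (gpoints X) f \<V> \<in> gcov X)"

definition small :: "'a gts \<Rightarrow> 'a set \<Rightarrow> bool" where
  "small X S \<longleftrightarrow> S \<subseteq> gpoints X \<and> (\<forall>\<U>\<in>gcov X. essentially_finite_on \<U> S)"

definition locally_small_gts :: "'a gts \<Rightarrow> bool" where
  "locally_small_gts X \<longleftrightarrow>
     is_gts X \<and>
     (\<exists>\<U>\<in>gcov X. \<Union>\<U> = gpoints X \<and> (\<forall>U\<in>\<U>. U \<in> gopen X \<and> small X U))"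

record 'a lss =
  lpoints :: "'a set"
  smops :: "'a set set"  \<comment> \<open>the family \<open>\<L>\<^sub>X\<close>\<close>

definition locally_small_space :: "'a lss \<Rightarrow> bool" where
  "locally_small_space X \<longleftrightarrow>
     smops X \<subseteq> Pow (lpoints X) \<and>
     {} \<in> smops X \<and>
     (\<forall>L\<in>smops X. \<forall>M\<in>smops X. L \<inter> M \<in> smops X \<and> L \<union> M \<in> smops X) \<and>
     \<Union>(smops X) = lpoints X"

text \<open>This is \<open>\<L>\<^sub>X\<^sup>o\<close>.\<close>

definition lopen :: "'a lss \<Rightarrow> 'a set set" where
  "lopen X = {V. V \<subseteq> lpoints X \<and> (\<forall>L\<in>smops X. V \<inter> L \<in> smops X)}"

definition bounded_map :: "'a lss \<Rightarrow> 'b lss \<Rightarrow> ('a \<Rightarrow> 'b) \<Rightarrow> bool" where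
  "bounded_map X Y f \<longleftrightarrow> refinement (smops X) (preimages (lpoints X) f (smops Y))"

definition continuous_map :: "'a lss \<Rightarrow> 'b lss \<Rightarrow> ('a \<Rightarrow> 'b) \<Rightarrow> bool" where
  "continuous_map X Y f \<longleftrightarrow> preimages (lpoints X) f (smops Y) \<subseteq> lopen X"

definition LSGTS :: "('a gts, 'a gts \<times> ('a \<Rightarrow> 'a) \<times> 'a gts) category" where
  "LSGTS = structured_sets {X. locally_small_gts X} gpoints strictly_continuous"

definition LSS :: "('a lss, 'a lss \<times> ('a \<Rightarrow> 'a) \<times> 'a lss) category" where
  "LSS = structured_sets {X. locally_small_space X} lpoints
           (\<lambda>X Y f. bounded_map X Y f \<and> continuous_map X Y f)"

end

theory Submission
  imports Defs
begin

text \<open>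
  A locally small gts is determined by its small open sets. Send \<open>X\<close> to its set of points together
  with the family of its small open sets; in the other direction, send a locally small space with
  smops \<open>\<L>\<close> to the gts whose open sets are the sets in \<open>\<L>\<^sup>o\<close> and whose admissible families are
  those families of open sets that are essentially finite on every member of \<open>\<L>\<close>.

  These assignments are mutually inverse. Starting from \<open>\<L>\<close>, the family \<open>\<L>\<close> itself is admissible
  in the constructed gts, so a small open set is a finite union of traces on members of \<open>\<L>\<close>
  and hence lies in \<open>\<L>\<close>. Starting from a gts with an admissible covering \<open>\<W>\<close> by small
  open sets, regularity along \<open>\<W>\<close> shows that openness can be tested on small open sets.
  Admissibility can be tested there as well: if \<open>\<U>\<close> is essentially finite on each \<open>W \<in> \<W>\<close>,
  finite families cover the traces \<open>W \<inter> \<Union>\<U>\<close>, transitivity glues them to an admissible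
  family refining \<open>\<U>\<close>, and saturation gives \<open>\<U>\<close>.

  Under this correspondence a mapping is strictly continuous if and only if it is bounded and
  continuous. Since points and mappings are never changed, an isomorphism of categories follows from
  the bijection on objects; this last step is valid for any two categories of structured sets.
\<close>

section \<open>Categories of structured sets\<close>

lemma structured_sets_simps [simp]:
  "Obj (structured_sets Os u P) = Os"
  "Id (structured_sets Os u P) S = (S, restrict (\<lambda>x. x) (u S), S)"
  "Comp (structured_sets Os u P) (S2, g, T2) (S1, f, T1) = (S1, compose (u S1) g f, T2)"
  by (simp_all add: structured_sets_def)

lemma structured_sets_Arr:
  "(S, f, T) \<in> Arr (structured_sets Os u P) \<longleftrightarrow>
     S \<in> Os \<and> T \<in> Os \<and> f \<in> u S \<rightarrow>\<^sub>E u T \<and> P S T f"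
  by (simp add: structured_sets_def)

lemma structured_sets_hom:
  "hom (structured_sets Os u P) S T =
     {(S, f, T) | f. S \<in> Os \<and> T \<in> Os \<and> f \<in> u S \<rightarrow>\<^sub>E u T \<and> P S T f}"
  by (auto simp: structured_sets_def hom_def)

lemma is_category_structured_sets:
  assumes ident: "\<And>S. S \<in> Os \<Longrightarrow> P S S (restrict (\<lambda>x. x) (u S))"
    and comp: "\<And>R S T f g. \<lbrakk>R \<in> Os; S \<in> Os; T \<in> Os; f \<in> u R \<rightarrow>\<^sub>E u S; g \<in> u S \<rightarrow>\<^sub>E u T;
                 P R S f; P S T g\<rbrakk> \<Longrightarrow> P R T (compose (u R) g f)"
  shows "is_category (structured_sets Os u P)"
  unfolding is_category_def
proof (intro conjI ballI)
  fix f assume "f \<in> Arr (structured_sets Os u P)"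
  then show "Dom (structured_sets Os u P) f \<in> Obj (structured_sets Os u P)"
    and "Cod (structured_sets Os u P) f \<in> Obj (structured_sets Os u P)"
    by (auto simp: structured_sets_def)
next
  fix S assume "S \<in> Obj (structured_sets Os u P)"
  then show "Id (structured_sets Os u P) S \<in> hom (structured_sets Os u P) S S"
    by (auto simp: structured_sets_hom ident)
next
  fix R S T f g
  assume "f \<in> hom (structured_sets Os u P) R S" "g \<in> hom (structured_sets Os u P) S T"
  moreover have "compose (u R) g' f' \<in> u R \<rightarrow>\<^sub>E u T"
    if "f' \<in> u R \<rightarrow>\<^sub>E u S" "g' \<in> u S \<rightarrow>\<^sub>E u T" for f' g'
    using that by (auto simp: compose_def PiE_iff)
  ultimately show "Comp (structured_sets Os u P) g f \<in> hom (structured_sets Os u P) R T"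
    by (auto simp: structured_sets_hom intro: comp)
next
  fix S T f
  assume "f \<in> hom (structured_sets Os u P) S T"
  then show "Comp (structured_sets Os u P) f (Id (structured_sets Os u P) S) = f"
    and "Comp (structured_sets Os u P) (Id (structured_sets Os u P) T) f = f"
    by (auto simp: structured_sets_hom compose_def fun_eq_iff PiE_iff extensional_def Pi_iff
        restrict_def)
next
  fix Q R S T f g h
  assume "f \<in> hom (structured_sets Os u P) Q R" "g \<in> hom (structured_sets Os u P) R S"
    "h \<in> hom (structured_sets Os u P) S T"
  then show "Comp (structured_sets Os u P) h (Comp (structured_sets Os u P) g f) =
      Comp (structured_sets Os u P) (Comp (structured_sets Os u P) h g) f"
    by (auto simp: structured_sets_hom compose_def fun_eq_iff PiE_iff)
qed

lemma concrete_category_structured_sets: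
  assumes "\<And>S. S \<in> Os \<Longrightarrow> P S S (restrict (\<lambda>x. x) (u S))"
    and "\<And>R S T f g. \<lbrakk>R \<in> Os; S \<in> Os; T \<in> Os; f \<in> u R \<rightarrow>\<^sub>E u S; g \<in> u S \<rightarrow>\<^sub>E u T;
           P R S f; P S T g\<rbrakk> \<Longrightarrow> P R T (compose (u R) g f)"
  shows "concrete_category (structured_sets Os u P) u (forget u)"
  unfolding concrete_category_def
proof (intro conjI)
  show "is_category (structured_sets Os u P)"
    using assms by (rule is_category_structured_sets)
  show "is_functor (structured_sets Os u P) set_category u (forget u)"
    by (auto simp: is_functor_def set_category_def structured_sets_hom forget_def)
  show "faithful (structured_sets Os u P) (forget u)"
    by (auto simp: faithful_def inj_on_def structured_sets_hom forget_def)
qed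

lemma is_functor_structured_sets:
  assumes obj: "\<And>S. S \<in> Os \<Longrightarrow> \<phi> S \<in> Qs"
    and points: "\<And>S. S \<in> Os \<Longrightarrow> v (\<phi> S) = u S"
    and mor: "\<And>S T f. \<lbrakk>S \<in> Os; T \<in> Os; f \<in> u S \<rightarrow>\<^sub>E u T; P S T f\<rbrakk> \<Longrightarrow> Q (\<phi> S) (\<phi> T) f"
  shows "is_functor (structured_sets Os u P) (structured_sets Qs v Q) \<phi>
           (\<lambda>(S, f, T). (\<phi> S, f, \<phi> T))"
  using assms by (auto simp: is_functor_def structured_sets_hom)

text \<open>On extensional mappings \<open>Q\<close> is \<open>P\<close> transported along the bijection of objects, so it inherits
  from \<open>P\<close> the closure under identities and composition.\<close>

lemma concretely_isomorphic_structured_sets: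
  assumes ident: "\<And>S. S \<in> Os \<Longrightarrow> P S S (restrict (\<lambda>x. x) (u S))"
    and comp: "\<And>R S T f g. \<lbrakk>R \<in> Os; S \<in> Os; T \<in> Os; f \<in> u R \<rightarrow>\<^sub>E u S; g \<in> u S \<rightarrow>\<^sub>E u T;
                 P R S f; P S T g\<rbrakk> \<Longrightarrow> P R T (compose (u R) g f)"
    and \<phi>: "\<And>S. S \<in> Os \<Longrightarrow> \<phi> S \<in> Qs" "\<And>S. S \<in> Os \<Longrightarrow> \<psi> (\<phi> S) = S"
    and \<psi>: "\<And>S. S \<in> Qs \<Longrightarrow> \<psi> S \<in> Os" "\<And>S. S \<in> Qs \<Longrightarrow> \<phi> (\<psi> S) = S"
    and points: "\<And>S. S \<in> Qs \<Longrightarrow> u (\<psi> S) = v S"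
    and mor: "\<And>S T f. \<lbrakk>S \<in> Qs; T \<in> Qs; f \<in> v S \<rightarrow>\<^sub>E v T\<rbrakk> \<Longrightarrow> P (\<psi> S) (\<psi> T) f \<longleftrightarrow> Q S T f"
  shows "concretely_isomorphic (structured_sets Os u P) u (forget u)
           (structured_sets Qs v Q) v (forget v)"
proof -
  let ?C = "structured_sets Os u P" and ?D = "structured_sets Qs v Q"
  let ?Fm = "\<lambda>(S, f, T). (\<phi> S, f, \<phi> T)" and ?Gm = "\<lambda>(S, f, T). (\<psi> S, f, \<psi> T)"
  have points': "v (\<phi> S) = u S" if "S \<in> Os" for S
    using points[of "\<phi> S"] that \<phi> by simp
  have mor': "Q (\<phi> S) (\<phi> T) f" if "S \<in> Os" "T \<in> Os" "f \<in> u S \<rightarrow>\<^sub>E u T" "P S T f" for S T f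
    using mor[of "\<phi> S" "\<phi> T" f] that by (simp add: \<phi> points')
  have C: "concrete_category ?C u (forget u)"
    using ident comp by (rule concrete_category_structured_sets)
  have identQ: "Q S S (restrict (\<lambda>x. x) (v S))" if "S \<in> Qs" for S
  proof -
    have "restrict (\<lambda>x. x) (v S) \<in> v S \<rightarrow>\<^sub>E v S" by auto
    then show ?thesis
      using mor[OF that that] ident[OF \<psi>(1)[OF that]] points[OF that] by simp
  qed
  have compQ: "Q R T (compose (v R) g f)"
    if "R \<in> Qs" "S \<in> Qs" "T \<in> Qs" "f \<in> v R \<rightarrow>\<^sub>E v S" "g \<in> v S \<rightarrow>\<^sub>E v T" "Q R S f" "Q S T g"
    for R S T f g
  proof -
    have "compose (v R) g f \<in> v R \<rightarrow>\<^sub>E v T"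
      using that(4,5) by (auto simp: compose_def PiE_iff)
    then show ?thesis
      using comp[of "\<psi> R" "\<psi> S" "\<psi> T" f g] that by (simp add: mor \<psi> points)
  qed
  have D: "concrete_category ?D v (forget v)"
    using identQ compQ by (rule concrete_category_structured_sets)
  have F: "is_functor ?C ?D \<phi> ?Fm"
    using \<phi>(1) points' mor' by (rule is_functor_structured_sets)
  have G: "is_functor ?D ?C \<psi> ?Gm"
    by (rule is_functor_structured_sets) (simp_all add: \<psi> points mor)
  have "category_isomorphism ?C ?D \<phi> ?Fm"
    unfolding category_isomorphism_def
  proof (intro conjI exI)
    show "is_functor ?C ?D \<phi> ?Fm" by (rule F)
    show "is_functor ?D ?C \<psi> ?Gm" by (rule G)
  qed (auto simp: \<phi> \<psi> structured_sets_Arr)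
  moreover have "\<forall>a\<in>Obj ?C. v (\<phi> a) = u a" "\<forall>f\<in>Arr ?C. forget v (?Fm f) = forget u f"
    by (auto simp: points' structured_sets_Arr forget_def)
  ultimately show ?thesis
    unfolding concretely_isomorphic_def using C D by blast
qed

section \<open>Essential finiteness and preimages\<close>

lemma cap1_eq_image: "cap1 V \<U> = (\<lambda>U. V \<inter> U) ` \<U>"
  by (auto simp: cap1_def)

lemma preimages_eq_image: "preimages X f \<V> = (\<lambda>V. f -` V \<inter> X) ` \<V>"
  by (auto simp: preimages_def)

text \<open>A finite family of traces lifts to a finite family of original sets, so essential finiteness
  on \<open>S\<close> becomes a covering condition in which no traces occur.\<close>

lemma essentially_finite_on_iff:
  "essentially_finite_on \<U> S \<longleftrightarrow> (\<exists>\<F>\<subseteq>\<U>. finite \<F> \<and> S \<inter> \<Union>\<U> \<subseteq> \<Union>\<F>)"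
proof
  assume "essentially_finite_on \<U> S"
  then obtain \<G> where \<G>: "\<G> \<subseteq> (\<lambda>U. S \<inter> U) ` \<U>" "finite \<G>" "\<Union>\<G> = \<Union>((\<lambda>U. S \<inter> U) ` \<U>)"
    unfolding essentially_finite_on_def essentially_finite_def cap1_eq_image by blast
  then obtain \<F> where "\<F> \<subseteq> \<U>" "finite \<F>" "\<G> = (\<lambda>U. S \<inter> U) ` \<F>"
    by (meson finite_subset_image)
  with \<G>(3) show "\<exists>\<F>\<subseteq>\<U>. finite \<F> \<and> S \<inter> \<Union>\<U> \<subseteq> \<Union>\<F>"
    by (intro exI[of _ \<F>]) auto
next
  assume "\<exists>\<F>\<subseteq>\<U>. finite \<F> \<and> S \<inter> \<Union>\<U> \<subseteq> \<Union>\<F>"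
  then obtain \<F> where "\<F> \<subseteq> \<U>" "finite \<F>" "S \<inter> \<Union>\<U> \<subseteq> \<Union>\<F>" by blast
  then show "essentially_finite_on \<U> S"
    unfolding essentially_finite_on_def essentially_finite_def cap1_eq_image
    by (intro exI[of _ "(\<lambda>U. S \<inter> U) ` \<F>"]) blast
qed

lemma essentially_finite_onI:
  "\<lbrakk>\<F> \<subseteq> \<U>; finite \<F>; S \<inter> \<Union>\<U> \<subseteq> \<Union>\<F>\<rbrakk> \<Longrightarrow> essentially_finite_on \<U> S"
  unfolding essentially_finite_on_iff by blast

lemma essentially_finite_on_mono:
  "essentially_finite_on \<U> S \<Longrightarrow> T \<subseteq> S \<Longrightarrow> essentially_finite_on \<U> T"
  unfolding essentially_finite_on_iff by blast

lemma essentially_finite_on_finite: "finite \<U> \<Longrightarrow> essentially_finite_on \<U> S"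
  unfolding essentially_finite_on_iff by blast

lemma essentially_finite_on_Un:
  assumes "essentially_finite_on \<U> S" "essentially_finite_on \<U> T"
  shows "essentially_finite_on \<U> (S \<union> T)"
proof -
  from assms obtain \<F> \<G> where "\<F> \<subseteq> \<U>" "finite \<F>" "S \<inter> \<Union>\<U> \<subseteq> \<Union>\<F>"
    and "\<G> \<subseteq> \<U>" "finite \<G>" "T \<inter> \<Union>\<U> \<subseteq> \<Union>\<G>"
    unfolding essentially_finite_on_iff by blast
  then show ?thesis
    unfolding essentially_finite_on_iff by (intro exI[of _ "\<F> \<union> \<G>"]) auto
qed

section \<open>The gts of a locally small space\<close>

definition gts_of_lss :: "'a lss \<Rightarrow> 'a gts" where
  "gts_of_lss X = \<lparr> gpoints = lpoints X, gopen = lopen X,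
     gcov = {\<U>. \<U> \<subseteq> lopen X \<and> (\<forall>L\<in>smops X. essentially_finite_on \<U> L)} \<rparr>"

lemma gts_of_lss_simps [simp]:
  "gpoints (gts_of_lss X) = lpoints X"
  "gopen (gts_of_lss X) = lopen X"
  "gcov (gts_of_lss X) = {\<U>. \<U> \<subseteq> lopen X \<and> (\<forall>L\<in>smops X. essentially_finite_on \<U> L)}"
  by (simp_all add: gts_of_lss_def)

lemma smops_finite_Union:
  assumes "locally_small_space X" "finite \<F>" "\<F> \<subseteq> smops X"
  shows "\<Union>\<F> \<in> smops X"
  using assms(2,3)
  by induction (use assms(1) in \<open>auto simp: locally_small_space_def\<close>)

lemma smops_subset_lopen: "locally_small_space X \<Longrightarrow> smops X \<subseteq> lopen X"
  by (auto simp: locally_small_space_def lopen_def)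

lemma lopen_Int:
  assumes "locally_small_space X" "V \<in> lopen X" "W \<in> lopen X"
  shows "V \<inter> W \<in> lopen X"
  using assms by (auto simp: lopen_def Int_assoc)

text \<open>Regularity of the constructed gts: on each \<open>L\<close>, finitely many traces suffice to build
  \<open>W \<inter> L\<close>.\<close>

lemma lopen_regular:
  assumes X: "locally_small_space X"
    and fin: "\<And>L. L \<in> smops X \<Longrightarrow> essentially_finite_on \<U> L"
    and W: "W \<subseteq> \<Union>\<U>" "\<And>U. U \<in> \<U> \<Longrightarrow> W \<inter> U \<in> lopen X"
  shows "W \<in> lopen X"
  unfolding lopen_def
proof (intro CollectI conjI ballI)
  show "W \<subseteq> lpoints X"
    using W unfolding lopen_def by blast
  fix L assume L: "L \<in> smops X"
  from fin[OF L] obtain \<F> where \<F>: "\<F> \<subseteq> \<U>" "finite \<F>" "L \<inter> \<Union>\<U> \<subseteq> \<Union>\<F>"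
    unfolding essentially_finite_on_iff by blast
  have "\<Union>((\<lambda>U. W \<inter> U \<inter> L) ` \<F>) \<in> smops X"
    using X \<F> W(2) L by (intro smops_finite_Union) (auto simp: lopen_def)
  also have "\<Union>((\<lambda>U. W \<inter> U \<inter> L) ` \<F>) = W \<inter> L \<inter> \<Union>\<F>" by auto
  also have "W \<inter> L \<inter> \<Union>\<F> = W \<inter> L" using \<F>(3) W(1) by blast
  finally show "W \<inter> L \<in> smops X" .
qed

lemma is_gts_gts_of_lss:
  assumes X: "locally_small_space X"
  shows "is_gts (gts_of_lss X)"
  unfolding is_gts_def gts_of_lss_simps
proof (intro conjI allI ballI impI)
  show "lopen X \<subseteq> Pow (lpoints X)"
    by (auto simp: lopen_def)
  show "{\<U>. \<U> \<subseteq> lopen X \<and> (\<forall>L\<in>smops X. essentially_finite_on \<U> L)} \<subseteq> Pow (lopen X)"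
    by blast
next
  fix \<U> assume \<U>: "\<U> \<subseteq> lopen X \<and> finite \<U>"
  then show "\<U> \<in> {\<U>. \<U> \<subseteq> lopen X \<and> (\<forall>L\<in>smops X. essentially_finite_on \<U> L)}"
    by (auto intro: essentially_finite_on_finite)
  show "\<Union>\<U> \<in> lopen X"
  proof (rule lopen_regular[OF X])
    show "essentially_finite_on \<U> L" for L
      using \<U> by (simp add: essentially_finite_on_finite)
    fix U assume "U \<in> \<U>"
    then have "\<Union>\<U> \<inter> U = U" by blast
    with \<open>U \<in> \<U>\<close> \<U> show "\<Union>\<U> \<inter> U \<in> lopen X" by auto
  qed simp
  have "finite \<U>" "\<U> \<subseteq> lopen X" using \<U> by auto
  then show "lpoints X \<inter> \<Inter>\<U> \<in> lopen X"
  proof induction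
    case empty
    have "lpoints X \<inter> L = L" if "L \<in> smops X" for L
      using that X by (auto simp: locally_small_space_def)
    then show ?case by (simp add: lopen_def)
  next
    case (insert U \<U>)
    then have "U \<inter> (lpoints X \<inter> \<Inter>\<U>) \<in> lopen X"
      using lopen_Int[OF X, of U "lpoints X \<inter> \<Inter>\<U>"] by simp
    then show ?case by (simp add: Int_left_commute)
  qed
next
  fix V \<U>
  assume V: "V \<in> lopen X"
    and \<U>: "\<U> \<in> {\<U>. \<U> \<subseteq> lopen X \<and> (\<forall>L\<in>smops X. essentially_finite_on \<U> L)}"
  have "essentially_finite_on (cap1 V \<U>) L" if "L \<in> smops X" for L
  proof -
    from \<U> that obtain \<F> where "\<F> \<subseteq> \<U>" "finite \<F>" "L \<inter> \<Union>\<U> \<subseteq> \<Union>\<F>"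
      unfolding essentially_finite_on_iff by blast
    then show ?thesis
      unfolding essentially_finite_on_iff cap1_eq_image
      by (intro exI[of _ "(\<lambda>U. V \<inter> U) ` \<F>"]) blast
  qed
  then show "cap1 V \<U> \<in> {\<U>. \<U> \<subseteq> lopen X \<and> (\<forall>L\<in>smops X. essentially_finite_on \<U> L)}"
    using V \<U> by (auto simp: cap1_def intro: lopen_Int[OF X])
next
  fix \<U> and \<V> :: "'a set \<Rightarrow> 'a set set"
  assume \<U>: "\<U> \<in> {\<U>. \<U> \<subseteq> lopen X \<and> (\<forall>L\<in>smops X. essentially_finite_on \<U> L)}"
    and \<V>: "\<forall>U\<in>\<U>. \<V> U \<in> {\<U>. \<U> \<subseteq> lopen X \<and> (\<forall>L\<in>smops X. essentially_finite_on \<U> L)} \<and>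
           \<Union>(\<V> U) = U"
  have "essentially_finite_on (\<Union>U\<in>\<U>. \<V> U) L" if L: "L \<in> smops X" for L
  proof -
    from \<U> L obtain \<F> where \<F>: "\<F> \<subseteq> \<U>" "finite \<F>" "L \<inter> \<Union>\<U> \<subseteq> \<Union>\<F>"
      unfolding essentially_finite_on_iff by blast
    from \<V> L have "\<forall>U\<in>\<U>. \<exists>\<G>. \<G> \<subseteq> \<V> U \<and> finite \<G> \<and> L \<inter> \<Union>(\<V> U) \<subseteq> \<Union>\<G>"
      unfolding essentially_finite_on_iff by blast
    then obtain \<G> where \<G>: "\<And>U. U \<in> \<U> \<Longrightarrow> \<G> U \<subseteq> \<V> U" "\<And>U. U \<in> \<U> \<Longrightarrow> finite (\<G> U)"
        "\<And>U. U \<in> \<U> \<Longrightarrow> L \<inter> \<Union>(\<V> U) \<subseteq> \<Union>(\<G> U)"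
      by metis
    have "L \<inter> \<Union>(\<Union>U\<in>\<U>. \<V> U) \<subseteq> \<Union>(\<Union>U\<in>\<F>. \<G> U)"
    proof
      fix x assume x: "x \<in> L \<inter> \<Union>(\<Union>U\<in>\<U>. \<V> U)"
      then have "x \<in> L \<inter> \<Union>\<U>" using \<V> by blast
      then obtain U where U: "U \<in> \<F>" "x \<in> U" using \<F>(3) by blast
      then have "x \<in> L \<inter> \<Union>(\<V> U)" using x \<V> \<F>(1) by blast
      then show "x \<in> \<Union>(\<Union>U\<in>\<F>. \<G> U)" using \<G>(3)[of U] U(1) \<F>(1) by blast
    qed
    moreover have "finite (\<Union>U\<in>\<F>. \<G> U)" using \<F>(1,2) \<G>(2) by auto
    moreover have "(\<Union>U\<in>\<F>. \<G> U) \<subseteq> (\<Union>U\<in>\<U>. \<V> U)"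
      by (rule UN_mono) (use \<F>(1) \<G>(1) in auto)
    ultimately show ?thesis
      by (intro essentially_finite_onI)
  qed
  then show "(\<Union>U\<in>\<U>. \<V> U) \<in> {\<U>. \<U> \<subseteq> lopen X \<and> (\<forall>L\<in>smops X. essentially_finite_on \<U> L)}"
    using \<V> by blast
next
  fix \<U> \<V>
  assume \<U>: "\<U> \<in> {\<U>. \<U> \<subseteq> lopen X \<and> (\<forall>L\<in>smops X. essentially_finite_on \<U> L)}"
    and \<V>: "\<V> \<subseteq> lopen X \<and> \<Union>\<U> = \<Union>\<V> \<and> refinement \<U> \<V>"
  from \<V> obtain r where r: "\<And>U. U \<in> \<U> \<Longrightarrow> r U \<in> \<V>" "\<And>U. U \<in> \<U> \<Longrightarrow> U \<subseteq> r U"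
    unfolding refinement_def by metis
  have "essentially_finite_on \<V> L" if "L \<in> smops X" for L
  proof -
    from \<U> that obtain \<F> where \<F>: "\<F> \<subseteq> \<U>" "finite \<F>" "L \<inter> \<Union>\<U> \<subseteq> \<Union>\<F>"
      unfolding essentially_finite_on_iff by blast
    have "\<Union>\<F> \<subseteq> \<Union>(r ` \<F>)"
      using \<F>(1) r(2) by fastforce
    moreover have "L \<inter> \<Union>\<V> \<subseteq> \<Union>\<F>"
      using \<V> \<F>(3) by simp
    ultimately show ?thesis
      by (intro essentially_finite_onI[of "r ` \<F>"]) (use \<F>(1,2) r(1) in auto)
  qed
  with \<V> show "\<V> \<in> {\<U>. \<U> \<subseteq> lopen X \<and> (\<forall>L\<in>smops X. essentially_finite_on \<U> L)}"
    by blast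
next
  fix \<U> W
  assume \<U>: "\<U> \<in> {\<U>. \<U> \<subseteq> lopen X \<and> (\<forall>L\<in>smops X. essentially_finite_on \<U> L)}"
    and W: "W \<subseteq> \<Union>\<U> \<and> cap1 W \<U> \<subseteq> lopen X"
  show "W \<in> lopen X"
  proof (rule lopen_regular[OF X])
    show "essentially_finite_on \<U> L" if "L \<in> smops X" for L
      using \<U> that by blast
    show "W \<subseteq> \<Union>\<U>" using W by blast
    show "W \<inter> U \<in> lopen X" if "U \<in> \<U>" for U
      using W that unfolding cap1_eq_image by blast
  qed
qed

text \<open>On \<open>L \<in> smops X\<close>, the one-element subfamily consisting of \<open>L\<close> covers everything.\<close>

lemma smops_admissible:
  assumes "locally_small_space X"
  shows "smops X \<in> gcov (gts_of_lss X)"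
proof -
  have "essentially_finite_on (smops X) L" if "L \<in> smops X" for L
    by (rule essentially_finite_onI[of "{L}"]) (use that in auto)
  then show ?thesis
    using smops_subset_lopen[OF assms] by simp
qed

lemma small_open_gts_of_lss_iff:
  assumes X: "locally_small_space X"
  shows "S \<in> lopen X \<and> small (gts_of_lss X) S \<longleftrightarrow> S \<in> smops X"
proof
  assume S: "S \<in> lopen X \<and> small (gts_of_lss X) S"
  then have "essentially_finite_on (smops X) S"
    using smops_admissible[OF X] unfolding small_def by blast
  then obtain \<F> where \<F>: "\<F> \<subseteq> smops X" "finite \<F>" "S \<inter> \<Union>(smops X) \<subseteq> \<Union>\<F>"
    unfolding essentially_finite_on_iff by blast
  have "\<Union>((\<lambda>L. S \<inter> L) ` \<F>) \<in> smops X"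
    using X \<F> S by (intro smops_finite_Union) (auto simp: lopen_def)
  also have "\<Union>((\<lambda>L. S \<inter> L) ` \<F>) = S \<inter> \<Union>\<F>" by auto
  also have "S \<inter> \<Union>\<F> = S"
  proof -
    have "S \<subseteq> \<Union>(smops X)" using S X by (auto simp: lopen_def locally_small_space_def)
    with \<F>(3) show ?thesis by blast
  qed
  finally show "S \<in> smops X" .
next
  assume "S \<in> smops X"
  with X show "S \<in> lopen X \<and> small (gts_of_lss X) S"
    using smops_subset_lopen[OF X] by (auto simp: small_def locally_small_space_def)
qed

lemma locally_small_gts_of_lss:
  assumes X: "locally_small_space X"
  shows "locally_small_gts (gts_of_lss X)"
  unfolding locally_small_gts_def
proof (intro conjI bexI)
  show "is_gts (gts_of_lss X)" by (rule is_gts_gts_of_lss[OF X])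
  show "smops X \<in> gcov (gts_of_lss X)" by (rule smops_admissible[OF X])
  show "\<Union>(smops X) = gpoints (gts_of_lss X)"
    using X by (simp add: locally_small_space_def)
  show "\<forall>U\<in>smops X. U \<in> gopen (gts_of_lss X) \<and> small (gts_of_lss X) U"
    using small_open_gts_of_lss_iff[OF X] by simp
qed

section \<open>The locally small space of a locally small gts\<close>

definition lss_of_gts :: "'a gts \<Rightarrow> 'a lss" where
  "lss_of_gts X = \<lparr> lpoints = gpoints X, smops = {S \<in> gopen X. small X S} \<rparr>"

lemma lss_of_gts_simps [simp]:
  "lpoints (lss_of_gts X) = gpoints X"
  "smops (lss_of_gts X) = {S \<in> gopen X. small X S}"
  by (simp_all add: lss_of_gts_def)

lemma lss_of_gts_of_lss: "locally_small_space X \<Longrightarrow> lss_of_gts (gts_of_lss X) = X"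
  by (simp add: lss_of_gts_def small_open_gts_of_lss_iff)

lemma
  assumes "is_gts X"
  shows gopen_subset_points: "U \<in> gopen X \<Longrightarrow> U \<subseteq> gpoints X"
    and gcov_subset_gopen: "\<U> \<in> gcov X \<Longrightarrow> \<U> \<subseteq> gopen X"
    and gcov_finite: "\<U> \<subseteq> gopen X \<Longrightarrow> finite \<U> \<Longrightarrow> \<U> \<in> gcov X"
    and gopen_finite_Union: "\<U> \<subseteq> gopen X \<Longrightarrow> finite \<U> \<Longrightarrow> \<Union>\<U> \<in> gopen X"
    and gopen_finite_Inter: "\<U> \<subseteq> gopen X \<Longrightarrow> finite \<U> \<Longrightarrow> gpoints X \<inter> \<Inter>\<U> \<in> gopen X"
    and gcov_stable: "V \<in> gopen X \<Longrightarrow> \<U> \<in> gcov X \<Longrightarrow> cap1 V \<U> \<in> gcov X"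
    and gcov_transitive: "\<U> \<in> gcov X \<Longrightarrow> (\<And>U. U \<in> \<U> \<Longrightarrow> \<V> U \<in> gcov X \<and> \<Union>(\<V> U) = U) \<Longrightarrow>
           (\<Union>U\<in>\<U>. \<V> U) \<in> gcov X"
    and gcov_saturated: "\<U> \<in> gcov X \<Longrightarrow> \<W> \<subseteq> gopen X \<Longrightarrow> \<Union>\<U> = \<Union>\<W> \<Longrightarrow> refinement \<U> \<W> \<Longrightarrow>
           \<W> \<in> gcov X"
    and gopen_regular: "\<U> \<in> gcov X \<Longrightarrow> W \<subseteq> \<Union>\<U> \<Longrightarrow> cap1 W \<U> \<subseteq> gopen X \<Longrightarrow> W \<in> gopen X"
  using assms unfolding is_gts_def by auto

lemma gopen_empty: "is_gts X \<Longrightarrow> {} \<in> gopen X"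
  using gopen_finite_Union[of X "{}"] by simp

lemma gopen_Un: "is_gts X \<Longrightarrow> U \<in> gopen X \<Longrightarrow> V \<in> gopen X \<Longrightarrow> U \<union> V \<in> gopen X"
  using gopen_finite_Union[of X "{U, V}"] by simp

lemma gopen_Int:
  assumes "is_gts X" "U \<in> gopen X" "V \<in> gopen X"
  shows "U \<inter> V \<in> gopen X"
proof -
  have "gpoints X \<inter> \<Inter>{U, V} = U \<inter> V"
    using gopen_subset_points[OF assms(1,2)] by auto
  then show ?thesis
    using gopen_finite_Inter[of X "{U, V}"] assms by simp
qed

lemma small_subset: "small X S \<Longrightarrow> T \<subseteq> S \<Longrightarrow> small X T"
  unfolding small_def by (blast intro: essentially_finite_on_mono)

lemma small_Un: "small X S \<Longrightarrow> small X T \<Longrightarrow> small X (S \<union> T)"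
  unfolding small_def by (blast intro: essentially_finite_on_Un)

lemma small_empty: "small X {}"
  by (auto simp: small_def essentially_finite_on_iff)

lemma locally_small_space_lss_of_gts:
  assumes X: "locally_small_gts X"
  shows "locally_small_space (lss_of_gts X)"
proof -
  have gts: "is_gts X" using X by (simp add: locally_small_gts_def)
  have "\<Union>{S \<in> gopen X. small X S} = gpoints X"
  proof
    show "\<Union>{S \<in> gopen X. small X S} \<subseteq> gpoints X"
      using gopen_subset_points[OF gts] by blast
    show "gpoints X \<subseteq> \<Union>{S \<in> gopen X. small X S}"
      using X unfolding locally_small_gts_def by blast
  qed
  then show ?thesis
    using gts gopen_subset_points[OF gts]
    unfolding locally_small_space_def lss_of_gts_simps
    by (auto intro: gopen_empty gopen_Un gopen_Int small_empty small_Un small_subset)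
qed

lemma lopen_lss_of_gts:
  assumes X: "locally_small_gts X"
  shows "lopen (lss_of_gts X) = gopen X"
proof
  have gts: "is_gts X" using X by (simp add: locally_small_gts_def)
  show "gopen X \<subseteq> lopen (lss_of_gts X)"
    using gopen_subset_points[OF gts] by (auto simp: lopen_def intro: gopen_Int[OF gts] small_subset)
  show "lopen (lss_of_gts X) \<subseteq> gopen X"
  proof
    fix V assume V: "V \<in> lopen (lss_of_gts X)"
    obtain \<W> where \<W>: "\<W> \<in> gcov X" "\<Union>\<W> = gpoints X" "\<And>W. W \<in> \<W> \<Longrightarrow> W \<in> gopen X \<and> small X W"
      using X unfolding locally_small_gts_def by blast
    show "V \<in> gopen X"
    proof (rule gopen_regular[OF gts \<W>(1)])
      show "V \<subseteq> \<Union>\<W>" using V by (simp add: \<W>(2) lopen_def)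
      show "cap1 V \<W> \<subseteq> gopen X" using V \<W>(3) by (auto simp: cap1_def lopen_def)
    qed
  qed
qed

text \<open>In the glueing step the traces \<open>W \<inter> \<Union>\<U>\<close> form an admissible family by stability, and each of
  them is the union of a finite, hence admissible, family of sets \<open>W \<inter> U\<close>.\<close>

lemma gcov_iff_essentially_finite_on_small:
  assumes X: "locally_small_gts X"
  shows "\<U> \<in> gcov X \<longleftrightarrow>
           \<U> \<subseteq> gopen X \<and> (\<forall>S\<in>gopen X. small X S \<longrightarrow> essentially_finite_on \<U> S)"
proof -
  have gts: "is_gts X" using X by (simp add: locally_small_gts_def)
  show ?thesis
  proof
    assume "\<U> \<in> gcov X"
    then show "\<U> \<subseteq> gopen X \<and> (\<forall>S\<in>gopen X. small X S \<longrightarrow> essentially_finite_on \<U> S)"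
      using gcov_subset_gopen[OF gts] by (auto simp: small_def)
  next
    assume \<U>: "\<U> \<subseteq> gopen X \<and> (\<forall>S\<in>gopen X. small X S \<longrightarrow> essentially_finite_on \<U> S)"
    obtain \<W> where \<W>: "\<W> \<in> gcov X" "\<Union>\<W> = gpoints X" "\<And>W. W \<in> \<W> \<Longrightarrow> W \<in> gopen X \<and> small X W"
      using X unfolding locally_small_gts_def by blast
    have "\<forall>T\<in>cap1 (\<Union>\<U>) \<W>. \<exists>\<G>. finite \<G> \<and> \<G> \<subseteq> gopen X \<and> refinement \<G> \<U> \<and> \<Union>\<G> = T"
    proof
      fix T assume "T \<in> cap1 (\<Union>\<U>) \<W>"
      then obtain W where W: "W \<in> \<W>" "T = \<Union>\<U> \<inter> W" by (auto simp: cap1_def)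
      with \<U> \<W>(3) obtain \<F> where \<F>: "\<F> \<subseteq> \<U>" "finite \<F>" "W \<inter> \<Union>\<U> \<subseteq> \<Union>\<F>"
        unfolding essentially_finite_on_iff by blast
      let ?\<G> = "(\<lambda>U. W \<inter> U) ` \<F>"
      have "?\<G> \<subseteq> gopen X" using \<F>(1) \<U> \<W>(3) W(1) by (auto intro!: gopen_Int[OF gts])
      moreover have "refinement ?\<G> \<U>" using \<F>(1) by (auto simp: refinement_def)
      moreover have "\<Union>?\<G> = T" using \<F>(1,3) W(2) by auto
      ultimately show "\<exists>\<G>. finite \<G> \<and> \<G> \<subseteq> gopen X \<and> refinement \<G> \<U> \<and> \<Union>\<G> = T"
        using \<F>(2) by (intro exI[of _ ?\<G>]) simp
    qed
    then obtain \<V> where \<V>: "\<And>T. T \<in> cap1 (\<Union>\<U>) \<W> \<Longrightarrow>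
        finite (\<V> T) \<and> \<V> T \<subseteq> gopen X \<and> refinement (\<V> T) \<U> \<and> \<Union>(\<V> T) = T"
      by metis
    have \<V>_cov: "\<V> T \<in> gcov X" and \<V>_Union: "\<Union>(\<V> T) = T"
      and \<V>_refinement: "refinement (\<V> T) \<U>"
      if "T \<in> cap1 (\<Union>\<U>) \<W>" for T
      using \<V>[OF that] by (simp_all add: gcov_finite[OF gts])
    have "cap1 (\<Union>\<U>) \<W> \<subseteq> gopen X"
    proof
      fix T assume "T \<in> cap1 (\<Union>\<U>) \<W>"
      from \<V>[OF this] show "T \<in> gopen X" using gopen_finite_Union[OF gts, of "\<V> T"] by simp
    qed
    moreover have "\<Union>\<U> \<subseteq> \<Union>\<W>" using \<U> gopen_subset_points[OF gts] \<W>(2) by blast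
    ultimately have "\<Union>\<U> \<in> gopen X" using gopen_regular[OF gts \<W>(1)] by blast
    then have "cap1 (\<Union>\<U>) \<W> \<in> gcov X" by (rule gcov_stable[OF gts _ \<W>(1)])
    then have "(\<Union>T\<in>cap1 (\<Union>\<U>) \<W>. \<V> T) \<in> gcov X"
      by (rule gcov_transitive[OF gts]) (simp add: \<V>_cov \<V>_Union)
    then show "\<U> \<in> gcov X"
    proof (rule gcov_saturated[OF gts])
      show "\<U> \<subseteq> gopen X" using \<U> by blast
      have "\<Union>(\<Union>T\<in>cap1 (\<Union>\<U>) \<W>. \<V> T) = (\<Union>T\<in>cap1 (\<Union>\<U>) \<W>. \<Union>(\<V> T))" by blast
      also have "\<dots> = \<Union>(cap1 (\<Union>\<U>) \<W>)" by (simp add: \<V>_Union)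
      also have "\<dots> = \<Union>\<U> \<inter> \<Union>\<W>" by (auto simp: cap1_def)
      also have "\<dots> = \<Union>\<U>" using \<open>\<Union>\<U> \<subseteq> \<Union>\<W>\<close> by blast
      finally show "\<Union>(\<Union>T\<in>cap1 (\<Union>\<U>) \<W>. \<V> T) = \<Union>\<U>" .
      show "refinement (\<Union>T\<in>cap1 (\<Union>\<U>) \<W>. \<V> T) \<U>"
        using \<V>_refinement unfolding refinement_def by blast
    qed
  qed
qed

lemma gts_of_lss_of_gts:
  assumes X: "locally_small_gts X"
  shows "gts_of_lss (lss_of_gts X) = X"
  using gcov_iff_essentially_finite_on_small[OF X]
  by (auto simp: gts_of_lss_def lopen_lss_of_gts[OF X] intro!: gts.equality)

section \<open>Strictly continuous and bounded continuous mappings\<close>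

lemma strictly_continuous_ident:
  assumes "is_gts X"
  shows "strictly_continuous X X (restrict (\<lambda>x. x) (gpoints X))"
  unfolding strictly_continuous_def
proof
  fix \<V> assume \<V>: "\<V> \<in> gcov X"
  have "restrict (\<lambda>x. x) (gpoints X) -` V \<inter> gpoints X = V" if "V \<in> \<V>" for V
    using gcov_subset_gopen[OF assms \<V>] gopen_subset_points[OF assms] that by fastforce
  then have "preimages (gpoints X) (restrict (\<lambda>x. x) (gpoints X)) \<V> = \<V>"
    by (simp add: preimages_eq_image)
  with \<V> show "preimages (gpoints X) (restrict (\<lambda>x. x) (gpoints X)) \<V> \<in> gcov X" by simp
qed

lemma strictly_continuous_compose:
  assumes f: "f \<in> gpoints X \<rightarrow>\<^sub>E gpoints Y"
    and "strictly_continuous X Y f" "strictly_continuous Y Z g"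
  shows "strictly_continuous X Z (compose (gpoints X) g f)"
proof -
  have "compose (gpoints X) g f -` V \<inter> gpoints X = f -` (g -` V \<inter> gpoints Y) \<inter> gpoints X" for V
    using f by (auto simp: compose_def)
  then have "preimages (gpoints X) (compose (gpoints X) g f) \<V> =
      preimages (gpoints X) f (preimages (gpoints Y) g \<V>)" for \<V>
    by (simp add: preimages_eq_image image_image)
  with assms(2,3) show ?thesis by (simp add: strictly_continuous_def)
qed

lemma strictly_continuous_iff_bounded_continuous:
  assumes X: "locally_small_space X" and Y: "locally_small_space Y"
    and f: "f \<in> lpoints X \<rightarrow> lpoints Y"
  shows "strictly_continuous (gts_of_lss X) (gts_of_lss Y) f \<longleftrightarrow>
           bounded_map X Y f \<and> continuous_map X Y f"
proof
  assume sc: "strictly_continuous (gts_of_lss X) (gts_of_lss Y) f"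
  have "continuous_map X Y f"
    unfolding continuous_map_def preimages_eq_image
  proof
    fix U assume "U \<in> (\<lambda>V. f -` V \<inter> lpoints X) ` smops Y"
    then obtain L where L: "L \<in> smops Y" "U = f -` L \<inter> lpoints X" by blast
    then have "{L} \<in> gcov (gts_of_lss Y)"
      using smops_subset_lopen[OF Y] by (auto intro: essentially_finite_on_finite)
    with sc have "preimages (lpoints X) f {L} \<in> gcov (gts_of_lss X)"
      unfolding strictly_continuous_def by fastforce
    with L(2) show "U \<in> lopen X" by (simp add: preimages_eq_image)
  qed
  moreover have "bounded_map X Y f"
    unfolding bounded_map_def refinement_def
  proof
    fix L assume L: "L \<in> smops X"
    \<comment> \<open>The preimage of the admissible covering of \<open>Y\<close> by its smops covers \<open>L\<close> finitely.\<close>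
    have "preimages (lpoints X) f (smops Y) \<in> gcov (gts_of_lss X)"
      using sc smops_admissible[OF Y] unfolding strictly_continuous_def by fastforce
    with L have "essentially_finite_on ((\<lambda>V. f -` V \<inter> lpoints X) ` smops Y) L"
      by (simp add: preimages_eq_image)
    then obtain \<G> where \<G>: "\<G> \<subseteq> (\<lambda>V. f -` V \<inter> lpoints X) ` smops Y" "finite \<G>"
        "L \<inter> \<Union>((\<lambda>V. f -` V \<inter> lpoints X) ` smops Y) \<subseteq> \<Union>\<G>"
      unfolding essentially_finite_on_iff by blast
    then obtain \<F> where \<F>: "\<F> \<subseteq> smops Y" "finite \<F>" "\<G> = (\<lambda>V. f -` V \<inter> lpoints X) ` \<F>"
      by (meson finite_subset_image)
    have "L \<subseteq> lpoints X" "\<Union>(smops Y) = lpoints Y"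
      using X Y L by (auto simp: locally_small_space_def)
    then have "L \<subseteq> \<Union>((\<lambda>V. f -` V \<inter> lpoints X) ` smops Y)"
      using f by fastforce
    then have "L \<subseteq> \<Union>\<G>" using \<G>(3) by (simp add: Int_absorb2)
    also have "\<Union>\<G> = f -` \<Union>\<F> \<inter> lpoints X" using \<F>(3) by auto
    finally have "L \<subseteq> f -` \<Union>\<F> \<inter> lpoints X" .
    moreover have "\<Union>\<F> \<in> smops Y"
      using smops_finite_Union[OF Y \<F>(2,1)] .
    ultimately show "\<exists>V\<in>preimages (lpoints X) f (smops Y). L \<subseteq> V"
      unfolding preimages_eq_image by blast
  qed
  ultimately show "bounded_map X Y f \<and> continuous_map X Y f" by blast
next
  assume "bounded_map X Y f \<and> continuous_map X Y f"
  then have bd: "\<And>L. L \<in> smops X \<Longrightarrow> \<exists>M\<in>smops Y. L \<subseteq> f -` M"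
    and cont: "\<And>M. M \<in> smops Y \<Longrightarrow> f -` M \<inter> lpoints X \<in> lopen X"
    by (auto simp: bounded_map_def continuous_map_def refinement_def preimages_eq_image)
  show "strictly_continuous (gts_of_lss X) (gts_of_lss Y) f"
    unfolding strictly_continuous_def gts_of_lss_simps
  proof (intro ballI CollectI conjI)
    fix \<V> assume \<V>: "\<V> \<in> {\<V>. \<V> \<subseteq> lopen Y \<and> (\<forall>L\<in>smops Y. essentially_finite_on \<V> L)}"
    show "preimages (lpoints X) f \<V> \<subseteq> lopen X"
      unfolding preimages_eq_image
    proof (rule image_subsetI)
      fix V assume V: "V \<in> \<V>"
      have "(f -` V \<inter> lpoints X) \<inter> L \<in> smops X" if L: "L \<in> smops X" for L
      proof -
        obtain M where M: "M \<in> smops Y" "L \<subseteq> f -` M" using bd[OF L] by blast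
        \<comment> \<open>Only sets in \<open>smops Y\<close> are known to have open preimages, so \<open>V\<close> is cut down to
          \<open>V \<inter> M\<close>, which is the same over \<open>L\<close>.\<close>
        have "V \<inter> M \<in> smops Y" using \<V> V M(1) by (auto simp: lopen_def)
        then have "f -` (V \<inter> M) \<inter> lpoints X \<inter> L \<in> smops X"
          using cont[of "V \<inter> M"] L unfolding lopen_def by blast
        also have "f -` (V \<inter> M) \<inter> lpoints X \<inter> L = (f -` V \<inter> lpoints X) \<inter> L"
          using M(2) by blast
        finally show ?thesis .
      qed
      then show "f -` V \<inter> lpoints X \<in> lopen X" by (simp add: lopen_def)
    qed
    fix L assume "L \<in> smops X"
    then obtain M where M: "M \<in> smops Y" "L \<subseteq> f -` M" using bd by blast
    then obtain \<F> where \<F>: "\<F> \<subseteq> \<V>" "finite \<F>" "M \<inter> \<Union>\<V> \<subseteq> \<Union>\<F>"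
      using \<V> unfolding essentially_finite_on_iff by blast
    have "L \<inter> \<Union>((\<lambda>V. f -` V \<inter> lpoints X) ` \<V>) \<subseteq> \<Union>((\<lambda>V. f -` V \<inter> lpoints X) ` \<F>)"
      using \<F>(3) M(2) by fastforce
    then show "essentially_finite_on (preimages (lpoints X) f \<V>) L"
      unfolding preimages_eq_image
      by (intro essentially_finite_onI[of "(\<lambda>V. f -` V \<inter> lpoints X) ` \<F>"])
        (use \<F>(1,2) in auto)
  qed
qed

section \<open>The concrete isomorphism\<close>

theorem theorem2p45:
  shows "concretely_isomorphic
           (LSGTS :: ('a gts, 'a gts \<times> ('a \<Rightarrow> 'a) \<times> 'a gts) category) gpoints (forget gpoints)
           (LSS :: ('a lss, 'a lss \<times> ('a \<Rightarrow> 'a) \<times> 'a lss) category) lpoints (forget lpoints)"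
  unfolding LSGTS_def LSS_def
proof (rule concretely_isomorphic_structured_sets[where \<phi> = lss_of_gts and \<psi> = gts_of_lss])
  fix X :: "'a gts"
  assume "X \<in> {X. locally_small_gts X}"
  then show "strictly_continuous X X (restrict (\<lambda>x. x) (gpoints X))"
    by (simp add: strictly_continuous_ident locally_small_gts_def)
next
  fix X Y Z :: "'a gts" and f g
  assume "f \<in> gpoints X \<rightarrow>\<^sub>E gpoints Y" "strictly_continuous X Y f" "strictly_continuous Y Z g"
  then show "strictly_continuous X Z (compose (gpoints X) g f)"
    by (rule strictly_continuous_compose)
next
  fix X Y :: "'a lss" and f
  assume "X \<in> {X. locally_small_space X}" "Y \<in> {X. locally_small_space X}"
    "f \<in> lpoints X \<rightarrow>\<^sub>E lpoints Y"
  then show "strictly_continuous (gts_of_lss X) (gts_of_lss Y) f \<longleftrightarrow>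
      bounded_map X Y f \<and> continuous_map X Y f"
    by (intro strictly_continuous_iff_bounded_continuous) auto
qed (simp_all add: locally_small_space_lss_of_gts locally_small_gts_of_lss
      gts_of_lss_of_gts lss_of_gts_of_lss)

end
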